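(* Let $n\ge 2$ and $1\le p\le n-2$. Then $$\operatorname{rank} K(n,p)=\binom{n-1}{p-1}+\sum_{r=p}^{n-1}\binom{n-1}{r}\binom{r-1}{p-1}.$$
   Context: Let $[n]=\{1,2,\dots,n\}$ with its usual order. $\mathcal{P}_n$ is the semigroup of all partial transformations of $[n]$ (maps whose domain and image are subsets of $[n]$, including the empty map), composed from left to right: $x(\alpha\beta)=(x\alpha)\beta$. A partial map $\alpha$ is isotone if $x\le y$ implies $x\alpha\le y\alpha$ for all $x,y\in\mathrm{Dom}\,\alpha$, and order-decreasing if $x\alpha\le x$ for all $x\in\mathrm{Dom}\,\alpha$. $\mathcal{LS}_n$ is the monoid of all isotone order-decreasing $\alpha\in\mathcal{P}_n$, and $\mathcal{SS}'_n=\{\alpha\in\mathcal{LS}_n: 1\notin \mathrm{Dom}\,\alpha\}$, a subsemigroup of $\mathcal{LS}_n$. For $0\le p\le n-1$, $K(n,p)=\{\alpha\in\mathcal{SS}'_n: |\mathrm{Im}\,\alpha|\le p\}$, a two-sided ideal of $\mathcal{SS}'_n$. The rank of a finitely generated semigroup $S$ is $\operatorname{rank}(S)=\min\{|A|: A\subseteq S,\ \langle A\rangle=S\}$, where $\langle A\rangle$ is the subsemigroup generated by $A$. *)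

theory Defs
  imports Main
begin

section \<open>Generated subsemigroups and rank\<close>

inductive_set subsemigroup_generated :: "('a \<Rightarrow> 'a \<Rightarrow> 'a) \<Rightarrow> 'a set \<Rightarrow> 'a set"
  for mult :: "'a \<Rightarrow> 'a \<Rightarrow> 'a" and A :: "'a set" where
  incl: "a \<in> A \<Longrightarrow> a \<in> subsemigroup_generated mult A"
| mult: "a \<in> subsemigroup_generated mult A \<Longrightarrow> b \<in> subsemigroup_generated mult A
    \<Longrightarrow> mult a b \<in> subsemigroup_generated mult A"

text \<open>The value is meaningful only for a finitely generated semigroup \<open>S\<close>. The condition
  \<open>finite A\<close> is needed because \<open>card\<close> is \<open>0\<close> on infinite sets.\<close>

definition semigroup_rank :: "('a \<Rightarrow> 'a \<Rightarrow> 'a) \<Rightarrow> 'a set \<Rightarrow> nat" where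
  "semigroup_rank mult S =
    (LEAST k. \<exists>A. A \<subseteq> S \<and> finite A \<and> card A = k \<and> subsemigroup_generated mult A = S)"


section \<open>Partial transformations\<close>

definition partial_transformations :: "nat \<Rightarrow> (nat \<rightharpoonup> nat) set" where
  "partial_transformations n = {\<alpha>. dom \<alpha> \<subseteq> {1..n} \<and> ran \<alpha> \<subseteq> {1..n}}"

text \<open>Maps act on the right, \<open>x(\<alpha>\<beta>) = (x\<alpha>)\<beta>\<close>, whereas \<open>map_comp\<close> applies its second
  argument first.\<close>

definition pcomp :: "(nat \<rightharpoonup> nat) \<Rightarrow> (nat \<rightharpoonup> nat) \<Rightarrow> (nat \<rightharpoonup> nat)" where
  "pcomp \<alpha> \<beta> = \<beta> \<circ>\<^sub>m \<alpha>"

definition isotone :: "(nat \<rightharpoonup> nat) \<Rightarrow> bool" where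
  "isotone \<alpha> \<longleftrightarrow> (\<forall>x\<in>dom \<alpha>. \<forall>y\<in>dom \<alpha>. x \<le> y \<longrightarrow> the (\<alpha> x) \<le> the (\<alpha> y))"

definition order_decreasing :: "(nat \<rightharpoonup> nat) \<Rightarrow> bool" where
  "order_decreasing \<alpha> \<longleftrightarrow> (\<forall>x\<in>dom \<alpha>. the (\<alpha> x) \<le> x)"

definition LS :: "nat \<Rightarrow> (nat \<rightharpoonup> nat) set" where
  "LS n = {\<alpha> \<in> partial_transformations n. isotone \<alpha> \<and> order_decreasing \<alpha>}"

definition SS' :: "nat \<Rightarrow> (nat \<rightharpoonup> nat) set" where
  "SS' n = {\<alpha> \<in> LS n. 1 \<notin> dom \<alpha>}"

definition K :: "nat \<Rightarrow> nat \<Rightarrow> (nat \<rightharpoonup> nat) set" where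
  "K n p = {\<alpha> \<in> SS' n. card (ran \<alpha>) \<le> p}"


section \<open>The minimum defining the rank is attained\<close>

lemma finite_K: "finite (K n p)"
proof (rule finite_subset)
  let ?M = "\<Union>D\<in>Pow {1..n}. {\<alpha>. dom \<alpha> = D \<and> ran \<alpha> \<subseteq> {1..n}}"
  show "K n p \<subseteq> ?M"
    by (auto simp: K_def SS'_def LS_def partial_transformations_def)
  show "finite ?M"
    by (intro finite_UN_I finite_set_of_finite_maps)
       (auto intro: finite_subset)
qed

lemma K_closed:
  assumes a: "\<alpha> \<in> K n p" and b: "\<beta> \<in> K n p"
  shows "pcomp \<alpha> \<beta> \<in> K n p"
proof -
  have val: "\<exists>y. \<alpha> x = Some y \<and> \<beta> y = Some z" if "pcomp \<alpha> \<beta> x = Some z" for x z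
    using that by (auto simp: pcomp_def map_comp_Some_iff)
  have ran: "ran (pcomp \<alpha> \<beta>) \<subseteq> ran \<beta>"
    by (auto simp: ran_def dest!: val)
  have dom: "dom (pcomp \<alpha> \<beta>) \<subseteq> dom \<alpha>"
    by (auto dest!: val)
  have "ran \<beta> \<subseteq> {1..n}"
    using b by (auto simp: K_def SS'_def LS_def partial_transformations_def)
  then have "finite (ran \<beta>)"
    by (rule finite_subset) simp
  then have "card (ran (pcomp \<alpha> \<beta>)) \<le> card (ran \<beta>)"
    using ran by (rule card_mono)
  also have "\<dots> \<le> p"
    using b by (simp add: K_def)
  finally have "card (ran (pcomp \<alpha> \<beta>)) \<le> p" .
  moreover have "isotone (pcomp \<alpha> \<beta>)"
    unfolding isotone_def
  proof (intro ballI impI)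
    fix x y assume "x \<in> dom (pcomp \<alpha> \<beta>)" "y \<in> dom (pcomp \<alpha> \<beta>)" and le: "x \<le> y"
    then obtain u' v' where **: "pcomp \<alpha> \<beta> x = Some u'" "pcomp \<alpha> \<beta> y = Some v'"
      by blast
    obtain u v where *: "\<alpha> x = Some u" "\<beta> u = Some u'" "\<alpha> y = Some v" "\<beta> v = Some v'"
      using val[OF **(1)] val[OF **(2)] by blast
    have "u \<le> v"
      using a * le by (force simp: K_def SS'_def LS_def isotone_def)
    then have "u' \<le> v'"
      using b * by (force simp: K_def SS'_def LS_def isotone_def)
    then show "the (pcomp \<alpha> \<beta> x) \<le> the (pcomp \<alpha> \<beta> y)"
      using ** by simp
  qed
  moreover have "order_decreasing (pcomp \<alpha> \<beta>)"
    unfolding order_decreasing_def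
  proof
    fix x assume "x \<in> dom (pcomp \<alpha> \<beta>)"
    then obtain u' where **: "pcomp \<alpha> \<beta> x = Some u'"
      by blast
    obtain u where *: "\<alpha> x = Some u" "\<beta> u = Some u'"
      using val[OF **] by blast
    have "u \<le> x"
      using a * bspec[of "dom \<alpha>" "\<lambda>x. the (\<alpha> x) \<le> x" x]
      by (simp add: K_def SS'_def LS_def order_decreasing_def domI)
    moreover have "u' \<le> u"
      using b * bspec[of "dom \<beta>" "\<lambda>x. the (\<beta> x) \<le> x" u]
      by (simp add: K_def SS'_def LS_def order_decreasing_def domI)
    ultimately show "the (pcomp \<alpha> \<beta> x) \<le> x"
      using ** by simp
  qed
  ultimately show ?thesis
    using a b ran dom
    unfolding K_def SS'_def LS_def partial_transformations_def by blast
qed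

lemma subsemigroup_generated_K: "subsemigroup_generated pcomp (K n p) = K n p"
proof
  show "subsemigroup_generated pcomp (K n p) \<subseteq> K n p"
  proof
    fix x assume "x \<in> subsemigroup_generated pcomp (K n p)"
    then show "x \<in> K n p"
      by induction (auto intro: K_closed)
  qed
qed (auto intro: subsemigroup_generated.incl)

end

theory Submission
  imports Defs
begin

text \<open>An idempotent of rank \<open>p\<close> is the largest element with its domain and kernel, so it is the first
  letter of every word representing it and lies in every generating set. The idempotents do not have
  \<open>1\<close> in their image, while the last letter of a word of rank \<open>p\<close> has the image of the product;
  hence each \<open>p\<close>-set containing \<open>1\<close> needs a further generator. Conversely, one well-chosen map for
  each such image suffices: together with the idempotents these maps generate all of rank \<open>p\<close>, and
  the generators of rank \<open>q \<le> n - 3\<close> are products of two elements of rank \<open>q + 1\<close>, because two spare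
  points of \<open>{2..n}\<close> lie outside their image or domain. Finally, idempotents of rank \<open>p\<close> correspond
  to pairs \<open>Min D \<in> M \<subseteq> D\<close> of domain and image.\<close>

section \<open>Composition, generated subsemigroups and pointwise membership in
  \<open>SS'\<close>\<close>

lemma pcomp_apply: "pcomp \<alpha> \<beta> x = (case \<alpha> x of None \<Rightarrow> None | Some y \<Rightarrow> \<beta> y)"
  by (simp add: pcomp_def map_comp_def)

lemma pcomp_eq_Some: "pcomp \<alpha> \<beta> x = Some z \<longleftrightarrow> (\<exists>y. \<alpha> x = Some y \<and> \<beta> y = Some z)"
  by (simp add: pcomp_apply split: option.splits)

lemma subsemigroup_generated_least:
  assumes "A \<subseteq> subsemigroup_generated mult B"
  shows "subsemigroup_generated mult A \<subseteq> subsemigroup_generated mult B"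
proof
  fix x assume "x \<in> subsemigroup_generated mult A"
  then show "x \<in> subsemigroup_generated mult B"
    by induction (use assms in \<open>auto intro: subsemigroup_generated.mult\<close>)
qed

text \<open>With \<open>dom\<close>, \<open>ran\<close> and \<open>the\<close> eliminated, every
  later membership proof splits into two obligations: bounds on a single value, and isotonicity. The
  bound \<open>2 \<le> x\<close> carries the condition that \<open>1\<close> is outside the
  domain.\<close>

lemma SS'_iff:
  "\<alpha> \<in> SS' n \<longleftrightarrow>
    (\<forall>x y. \<alpha> x = Some y \<longrightarrow> 2 \<le> x \<and> x \<le> n \<and> 1 \<le> y \<and> y \<le> x) \<and>
    (\<forall>x y u v. \<alpha> x = Some u \<longrightarrow> \<alpha> y = Some v \<longrightarrow> x \<le> y \<longrightarrow> u \<le> v)"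
  (is "?L \<longleftrightarrow> ?R")
proof
  assume L: ?L
  have "2 \<le> x \<and> x \<le> n \<and> 1 \<le> y \<and> y \<le> x" if "\<alpha> x = Some y" for x y
  proof -
    have x: "x \<in> dom \<alpha>" and y: "y \<in> ran \<alpha>"
      using that by (auto intro: ranI)
    then have "x \<in> {1..n}" "y \<in> {1..n}" "x \<noteq> 1" "the (\<alpha> x) \<le> x"
      using L unfolding SS'_def LS_def partial_transformations_def order_decreasing_def by blast+
    then show ?thesis using that by auto
  qed
  moreover have "u \<le> v" if "\<alpha> x = Some u" "\<alpha> y = Some v" "x \<le> y" for x y u v
    using L that unfolding SS'_def LS_def isotone_def by force
  ultimately show ?R by blast
next
  assume ?R
  then show ?L
    unfolding SS'_def LS_def partial_transformations_def order_decreasing_def isotone_def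
    by (fastforce simp: ran_def)
qed

lemma SS'_bounds:
  assumes "\<alpha> \<in> SS' n" "\<alpha> x = Some y"
  shows "2 \<le> x" "x \<le> n" "1 \<le> y" "y \<le> x"
  using assms unfolding SS'_iff by blast+

lemma SS'_mono: "\<alpha> \<in> SS' n \<Longrightarrow> \<alpha> x = Some u \<Longrightarrow> \<alpha> y = Some v \<Longrightarrow> x \<le> y \<Longrightarrow> u \<le> v"
  unfolding SS'_iff by blast

lemma ran_SS'_subset: "\<alpha> \<in> SS' n \<Longrightarrow> ran \<alpha> \<subseteq> {1..n}"
  unfolding ran_def using SS'_bounds by fastforce

lemma finite_ran_SS': "\<alpha> \<in> SS' n \<Longrightarrow> finite (ran \<alpha>)"
  by (rule finite_subset[OF ran_SS'_subset]) auto

section \<open>Rank layers, idempotents and the additional generators\<close>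

definition SS'_rank :: "nat \<Rightarrow> nat \<Rightarrow> (nat \<rightharpoonup> nat) set" where
  "SS'_rank n q = {\<alpha> \<in> SS' n. card (ran \<alpha>) = q}"

definition idempotents :: "nat \<Rightarrow> nat \<Rightarrow> (nat \<rightharpoonup> nat) set" where
  "idempotents n q = {\<alpha> \<in> SS'_rank n q. \<forall>x y. \<alpha> x = Some y \<longrightarrow> \<alpha> y = Some y}"

text \<open>If \<open>1 \<in> I\<close>, the positive points below \<open>gap I\<close> form the
  initial interval of \<open>I\<close>. As \<open>1\<close> is outside every domain, no map with
  image \<open>I\<close> can fix a point of this interval, and the gap is the spare point from which
  it can be hit.\<close>

definition gap :: "nat set \<Rightarrow> nat" where
  "gap I = (LEAST k. 0 < k \<and> k \<notin> I)"

text \<open>Among the maps of \<open>SS' n\<close> with image \<open>I \<ni> 1\<close>, the map \<open>shift_below_gap I\<close> has the smallest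
  possible domain elements, so every other one factors through it.\<close>

definition shift_below_gap :: "nat set \<Rightarrow> (nat \<rightharpoonup> nat)" where
  "shift_below_gap I =
    (\<lambda>x. if x \<in> insert (gap I) I - {1} then Some (if x \<le> gap I then x - 1 else x) else None)"

definition pointed_sets :: "nat \<Rightarrow> nat \<Rightarrow> nat set set" where
  "pointed_sets n q = {I. I \<subseteq> {1..n} \<and> 1 \<in> I \<and> card I = q}"

lemma gap_pos: "finite I \<Longrightarrow> 0 < gap I" and gap_notin: "finite I \<Longrightarrow> gap I \<notin> I"
proof -
  assume "finite I"
  then obtain k where "k \<notin> insert 0 I"
    using ex_new_if_finite[of "insert 0 I"] infinite_UNIV_nat by blast
  then have "0 < k \<and> k \<notin> I" by auto
  then have "0 < gap I \<and> gap I \<notin> I"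
    unfolding gap_def by (rule LeastI)
  then show "0 < gap I" "gap I \<notin> I" by auto
qed

lemma less_gap: "0 < k \<Longrightarrow> k < gap I \<Longrightarrow> k \<in> I"
  unfolding gap_def using not_less_Least by blast

lemma gap_le:
  assumes "I \<subseteq> {1..n}" "card I < n"
  shows "gap I \<le> n"
proof (rule ccontr)
  assume "\<not> gap I \<le> n"
  then have "{1..n} \<subseteq> I" using less_gap[of _ I] by auto
  then show False using assms card_mono[of I "{1..n}"] finite_subset[OF assms(1)] by auto
qed

text \<open>Since \<open>q < n\<close>, some point of \<open>{1..n}\<close> is missing from
  \<open>I\<close>, so the gap lies in \<open>{2..n}\<close>. A point of \<open>I\<close> below the
  gap is hit by its successor, which is in \<open>I\<close> or is the gap itself; a point above the
  gap is fixed.\<close>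

lemma shift_below_gap:
  assumes "I \<in> pointed_sets n q" "q < n"
  shows "shift_below_gap I \<in> SS'_rank n q" "ran (shift_below_gap I) = I"
proof -
  let ?g = "gap I"
  have I: "I \<subseteq> {1..n}" "1 \<in> I" "card I = q" and fin: "finite I"
    using assms finite_subset[of I "{1..n}"] by (auto simp: pointed_sets_def)
  note g = gap_pos[OF fin] gap_notin[OF fin] gap_le[OF I(1)] less_gap[of _ I]
  have g2: "2 \<le> ?g" "?g \<le> n" using g I assms
    by (metis One_nat_def Suc_1 Suc_leI le_neq_implies_less, metis)
  show ran: "ran (shift_below_gap I) = I"
  proof
    show "ran (shift_below_gap I) \<subseteq> I"
    proof
      fix y assume "y \<in> ran (shift_below_gap I)"
      then obtain x where "shift_below_gap I x = Some y" by (auto simp: ran_def)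
      then have x: "x \<in> insert ?g I - {1}" "y = (if x \<le> ?g then x - 1 else x)"
        unfolding shift_below_gap_def by (auto split: if_splits)
      then have "x \<ge> 2" using g2 I(1) by (cases "x = ?g") force+
      then show "y \<in> I" using x g(4)[of "x - 1"] by (cases "x \<le> ?g") auto
    qed
    show "I \<subseteq> ran (shift_below_gap I)"
    proof
      fix y assume y: "y \<in> I"
      show "y \<in> ran (shift_below_gap I)"
      proof (cases "y < ?g")
        case True
        then have "Suc y \<in> insert ?g I - {1}"
          using g(4)[of "Suc y"] y I(1) by (cases "Suc y = ?g") auto
        then have "shift_below_gap I (Suc y) = Some y"
          using True by (auto simp: shift_below_gap_def)
        then show ?thesis by (rule ranI)
      next
        case False
        then have "shift_below_gap I y = Some y"
          using y g g2 by (auto simp: shift_below_gap_def)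
        then show ?thesis by (rule ranI)
      qed
    qed
  qed
  have "shift_below_gap I \<in> SS' n"
    unfolding SS'_iff shift_below_gap_def using g2 I(1) by (fastforce split: if_splits)
  then show "shift_below_gap I \<in> SS'_rank n q"
    using ran I by (simp add: SS'_rank_def)
qed

section \<open>Generation of all maps of a given rank\<close>

text \<open>Raising the largest non-fixed image point \<open>a\<close> to \<open>a + 1\<close> stays inside the semigroup, and an
  idempotent lowers it again.\<close>

lemma avoiding_1_generated_by_idempotents:
  assumes "\<alpha> \<in> SS'_rank n q" "1 \<notin> ran \<alpha>"
  shows "\<alpha> \<in> subsemigroup_generated pcomp (idempotents n q)"
  using assms
\<comment> \<open>Replacing the image point \<open>a\<close> by \<open>a + 1\<close> lowers this sum
  by one.\<close>
proof (induction "\<Sum>y\<in>ran \<alpha>. n - y" arbitrary: \<alpha> rule: less_induct)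
  case less
  have \<alpha>: "\<alpha> \<in> SS' n" "card (ran \<alpha>) = q" using less.prems by (auto simp: SS'_rank_def)
  note fin = finite_ran_SS'[OF \<alpha>(1)]
  let ?N = "{y \<in> ran \<alpha>. \<alpha> y \<noteq> Some y}"
  show ?case
  proof (cases "?N = {}")
    case True
    then have "\<alpha> \<in> idempotents n q"
      using less.prems by (auto simp: idempotents_def ran_def)
    then show ?thesis by (rule subsemigroup_generated.incl)
  next
    case False
    define a where "a = Max ?N"
    have "finite ?N" using fin by simp
    then have aN: "a \<in> ?N" and amax: "\<And>y. y \<in> ?N \<Longrightarrow> y \<le> a"
      using False Max_in[of ?N] unfolding a_def by auto
    then obtain x where x: "\<alpha> x = Some a" by (auto simp: ran_def)
    \<comment> \<open>As \<open>a\<close> is not fixed, all its preimages are strictly larger, so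
      sending them to \<open>a + 1\<close> is still order-decreasing.\<close>
    have above: "a + 1 \<le> z" if "\<alpha> z = Some a" for z
      using SS'_bounds[OF \<alpha>(1) that] aN that by (cases "z = a") auto
    \<comment> \<open>By maximality of \<open>a\<close>, an image point \<open>a + 1\<close> would
      be fixed; but \<open>x \<ge> a + 1\<close> is sent to \<open>a\<close>, against
      isotonicity.\<close>
    have notin: "a + 1 \<notin> ran \<alpha>"
    proof
      assume "a + 1 \<in> ran \<alpha>"
      then have "\<alpha> (a + 1) = Some (a + 1)" using amax[of "a + 1"] by force
      then show False using SS'_mono[OF \<alpha>(1) _ x above[OF x]] by force
    qed
    have a: "2 \<le> a" "a + 1 \<le> n"
    proof -
      have "1 \<le> a" "a \<noteq> 1" using SS'_bounds[OF \<alpha>(1) x] aN less.prems by auto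
      then show "2 \<le> a" by simp
      show "a + 1 \<le> n" using above[OF x] SS'_bounds[OF \<alpha>(1) x] by simp
    qed
    define \<beta> where "\<beta> = (\<lambda>z. if \<alpha> z = Some a then Some (a + 1) else \<alpha> z)"
    \<comment> \<open>Besides lowering \<open>a + 1\<close>, the map \<open>f\<close> fixes all of
      \<open>ran \<alpha>\<close>, including \<open>a\<close>; this makes it idempotent with image
      exactly \<open>ran \<alpha>\<close>.\<close>
    define f where "f = (\<lambda>z. if z = a + 1 then Some a else if z \<in> ran \<alpha> then Some z else None)"
    have comp: "\<alpha> = pcomp \<beta> f"
    proof
      fix z
      show "\<alpha> z = pcomp \<beta> f z"
        using notin ranI[of \<alpha> z] by (cases "\<alpha> z") (auto simp: pcomp_apply \<beta>_def f_def)
    qed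
    have ran\<beta>: "ran \<beta> = insert (a + 1) (ran \<alpha> - {a})"
    proof
      show "ran \<beta> \<subseteq> insert (a + 1) (ran \<alpha> - {a})"
        unfolding \<beta>_def ran_def by (auto split: if_splits)
      show "insert (a + 1) (ran \<alpha> - {a}) \<subseteq> ran \<beta>"
      proof
        fix y assume y: "y \<in> insert (a + 1) (ran \<alpha> - {a})"
        show "y \<in> ran \<beta>"
        proof (cases "y = a + 1")
          case True
          then have "\<beta> x = Some y" using x by (simp add: \<beta>_def)
          then show ?thesis by (rule ranI)
        next
          case False
          then obtain z where "\<alpha> z = Some y" "y \<noteq> a" using y by (auto simp: ran_def)
          then have "\<beta> z = Some y" by (simp add: \<beta>_def)
          then show ?thesis by (rule ranI)
        qed
      qed
    qed
    have "card (ran \<beta>) = q"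
      unfolding ran\<beta> using \<alpha>(2) aN notin fin card_Suc_Diff1[of "ran \<alpha>" a] by simp
    moreover have "\<beta> \<in> SS' n"
    proof -
      have "u \<le> v" if uv: "\<beta> y = Some u" "\<beta> z = Some v" "y \<le> z" for y z u v
      proof -
        obtain u' v' where uv': "\<alpha> y = Some u'" "\<alpha> z = Some v'"
          using uv unfolding \<beta>_def by (auto split: if_splits)
        then have le: "u' \<le> v'" using SS'_mono[OF \<alpha>(1)] uv(3) by blast
        show ?thesis
          using uv uv' le notin ranI[of \<alpha> z v'] unfolding \<beta>_def
          by (auto split: if_splits)
      qed
      moreover have "2 \<le> y \<and> y \<le> n \<and> 1 \<le> u \<and> u \<le> y" if "\<beta> y = Some u" for y u
        using that SS'_bounds[OF \<alpha>(1)] above[of y] unfolding \<beta>_def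
        by (auto split: if_splits)
      ultimately show ?thesis unfolding SS'_iff by blast
    qed
    ultimately have \<beta>: "\<beta> \<in> SS'_rank n q" by (simp add: SS'_rank_def)
    have ge: "2 \<le> y \<and> y \<le> n" if "y \<in> ran \<alpha>" for y
    proof -
      have "y \<noteq> 1" using that less.prems by blast
      moreover have "1 \<le> y" "y \<le> n" using ran_SS'_subset[OF \<alpha>(1)] that by auto
      ultimately show ?thesis by linarith
    qed
    have ranf: "ran f = ran \<alpha>"
    proof
      have "y \<in> ran \<alpha>" if "f z = Some y" for y z
        using that aN by (auto simp: f_def split: if_splits)
      then show "ran f \<subseteq> ran \<alpha>" unfolding ran_def[of f] by blast
      have "f y = Some y" if "y \<in> ran \<alpha>" for y
        using that notin by (auto simp: f_def)
      then show "ran \<alpha> \<subseteq> ran f" by (blast intro: ranI)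
    qed
    have "f \<in> SS' n"
      unfolding SS'_iff f_def using ge a by (fastforce split: if_splits)
    then have "f \<in> idempotents n q"
      using ranf \<alpha>(2) aN notin by (auto simp: idempotents_def SS'_rank_def f_def split: if_splits)
    moreover have "\<beta> \<in> subsemigroup_generated pcomp (idempotents n q)"
    proof (rule less.hyps[OF _ \<beta>])
      have "(\<Sum>y\<in>ran \<beta>. n - y) = (n - (a + 1)) + (\<Sum>y\<in>ran \<alpha> - {a}. n - y)"
        unfolding ran\<beta> using fin notin by (subst sum.insert) auto
      also have "\<dots> < (n - a) + (\<Sum>y\<in>ran \<alpha> - {a}. n - y)" using a by simp
      also have "\<dots> = (\<Sum>y\<in>ran \<alpha>. n - y)" using aN fin by (subst sum.remove[of _ a]) auto
      finally show "(\<Sum>y\<in>ran \<beta>. n - y) < (\<Sum>y\<in>ran \<alpha>. n - y)" .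
      show "1 \<notin> ran \<beta>" using less.prems ran\<beta> a by auto
    qed
    ultimately show ?thesis
      unfolding comp by (blast intro: subsemigroup_generated.intros)
  qed
qed

text \<open>Fixed points propagate downwards: if \<open>x + 1\<close> is fixed and \<open>x\<close>
  is in the image, a preimage of \<open>x\<close> is at least \<open>x\<close> because the map
  decreases and at most \<open>x\<close> because it is isotone. The descent ends at
  \<open>1\<close>, which is outside the domain.\<close>

lemma fixed_below_gap_absurd:
  assumes "\<alpha> \<in> SS' n" "x < gap (ran \<alpha>)"
  shows "\<alpha> x \<noteq> Some x"
  using assms(2)
proof (induction x)
  case 0
  then show ?case using SS'_bounds(1)[OF assms(1), of 0 0] by auto
next
  case (Suc x)
  show ?case
  proof
    assume S: "\<alpha> (Suc x) = Some (Suc x)"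
    have "0 < x" using SS'_bounds(1)[OF assms(1) S] by simp
    then have "x \<in> ran \<alpha>" using less_gap[of x] Suc.prems by simp
    then obtain y where y: "\<alpha> y = Some x" by (auto simp: ran_def)
    have "x \<le> y" using SS'_bounds[OF assms(1) y] by simp
    moreover have "y \<le> x" using SS'_mono[OF assms(1) S y] by (cases "Suc x \<le> y") auto
    ultimately show False using y Suc by simp
  qed
qed

text \<open>A map with \<open>1\<close> in its image factors as a map of the same rank avoiding
  \<open>1\<close>, followed by \<open>shift_below_gap\<close> of its image; the first factor is a
  product of idempotents.\<close>

lemma SS'_rank_subset_generated:
  assumes "q < n"
  shows "SS'_rank n q \<subseteq>
    subsemigroup_generated pcomp (idempotents n q \<union> shift_below_gap ` pointed_sets n q)"
    (is "_ \<subseteq> ?S")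
proof
  fix \<alpha> assume \<alpha>q: "\<alpha> \<in> SS'_rank n q"
  have sub: "subsemigroup_generated pcomp (idempotents n q) \<subseteq> ?S"
    by (rule subsemigroup_generated_least) (auto intro: subsemigroup_generated.incl)
  show "\<alpha> \<in> ?S"
  proof (cases "1 \<in> ran \<alpha>")
    case False
    then show ?thesis using avoiding_1_generated_by_idempotents[OF \<alpha>q] sub by blast
  next
    case True
    have \<alpha>: "\<alpha> \<in> SS' n" "card (ran \<alpha>) = q" using \<alpha>q by (auto simp: SS'_rank_def)
    note fin = finite_ran_SS'[OF \<alpha>(1)]
    let ?g = "gap (ran \<alpha>)"
    note g = gap_pos[OF fin] gap_notin[OF fin]
    have g1: "1 < ?g" using True g by (cases "?g = 1") auto
    have I: "ran \<alpha> \<in> pointed_sets n q"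
      using True \<alpha> ran_SS'_subset by (simp add: pointed_sets_def)
    \<comment> \<open>On the image of \<open>\<alpha>\<close>, \<open>s\<close> is a right inverse
      of the shift: it chooses a preimage of each point.\<close>
    define s where "s y = (if y < ?g then y + 1 else y)" for y :: nat
    define \<beta> where "\<beta> = (\<lambda>x. map_option s (\<alpha> x))"
    have val: "shift_below_gap (ran \<alpha>) (s y) = Some y" if "y \<in> ran \<alpha>" for y
    proof -
      have "y \<noteq> ?g" "1 \<le> y" using that g ran_SS'_subset[OF \<alpha>(1)] by auto
      moreover have "y + 1 \<in> insert ?g (ran \<alpha>)" if "y < ?g"
        using that less_gap[of "y + 1" "ran \<alpha>"] by (cases "y + 1 = ?g") auto
      ultimately show ?thesis using that g1 unfolding shift_below_gap_def s_def by auto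
    qed
    have comp: "\<alpha> = pcomp \<beta> (shift_below_gap (ran \<alpha>))"
    proof
      fix z
      show "\<alpha> z = pcomp \<beta> (shift_below_gap (ran \<alpha>)) z"
        using val ranI[of \<alpha> z] by (cases "\<alpha> z") (auto simp: pcomp_apply \<beta>_def)
    qed
    have ran\<beta>: "ran \<beta> = s ` ran \<alpha>"
      unfolding \<beta>_def ran_def by auto
    have "inj_on s (ran \<alpha>)"
      by (rule inj_on_inverseI[where g = "\<lambda>z. the (shift_below_gap (ran \<alpha>) z)"]) (simp add: val)
    then have "card (ran \<beta>) = q" using ran\<beta> \<alpha>(2) by (simp add: card_image)
    moreover have "\<beta> \<in> SS' n"
    proof -
      have "s u \<le> s v" if "u \<le> v" for u v
        using that unfolding s_def by auto
      \<comment> \<open>Only values below the gap are raised; none of them is taken at a fixed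
        point, so there is room for the increment.\<close>
      moreover have "1 \<le> s u \<and> s u \<le> x" if "\<alpha> x = Some u" for x u
      proof -
        have "u \<noteq> x" if "u < ?g"
          using fixed_below_gap_absurd[OF \<alpha>(1) that] \<open>\<alpha> x = Some u\<close> by blast
        then show ?thesis using SS'_bounds[OF \<alpha>(1) that] unfolding s_def by auto
      qed
      ultimately show ?thesis
        using SS'_bounds[OF \<alpha>(1)] SS'_mono[OF \<alpha>(1)] unfolding SS'_iff \<beta>_def by fastforce
    qed
    ultimately have "\<beta> \<in> SS'_rank n q" by (simp add: SS'_rank_def)
    moreover have "1 \<notin> ran \<beta>"
    proof
      assume "1 \<in> ran \<beta>"
      then obtain y where "y \<in> ran \<alpha>" "s y = 1" unfolding ran\<beta> by auto
      moreover have "1 \<le> y" using \<open>y \<in> ran \<alpha>\<close> ran_SS'_subset[OF \<alpha>(1)] by auto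
      ultimately show False using g1 unfolding s_def by (auto split: if_splits)
    qed
    ultimately have "\<beta> \<in> ?S" using avoiding_1_generated_by_idempotents sub by blast
    moreover have "shift_below_gap (ran \<alpha>) \<in> ?S"
      using I by (auto intro: subsemigroup_generated.incl)
    ultimately show ?thesis
      by (subst comp) (rule subsemigroup_generated.mult)
  qed
qed

section \<open>Factoring rank \<open>q\<close> through rank \<open>q + 1\<close>\<close>

definition identity_on :: "nat set \<Rightarrow> (nat \<rightharpoonup> nat)" where
  "identity_on M = (\<lambda>x. if x \<in> M then Some x else None)"

lemma identity_on_SS'_rank:
  assumes "M \<subseteq> {2..n}" "card M = q"
  shows "identity_on M \<in> SS'_rank n q"
proof -
  have "ran (identity_on M) = M" by (auto simp: identity_on_def ran_def)
  moreover have "identity_on M \<in> SS' n"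
    unfolding SS'_iff identity_on_def using assms(1) by (auto split: if_splits)
  ultimately show ?thesis using assms by (simp add: SS'_rank_def)
qed

text \<open>\<open>{2..n}\<close> has \<open>n - 1\<close> elements, so the bound with
  \<open>3\<close> leaves at least two of them free.\<close>

lemma two_points_outside:
  assumes "M \<subseteq> {2..n}" "card M + 3 \<le> n"
  obtains c c' where "c \<in> {2..n} - M" "c' \<in> {2..n} - M" "c \<noteq> c'"
proof -
  have "card ({2..n} - M) = n - 1 - card M"
    using assms(1) by (subst card_Diff_subset) (auto intro: finite_subset)
  then have "2 \<le> card ({2..n} - M)" using assms(2) by simp
  then obtain T where "T \<subseteq> {2..n} - M" "card T = 2" by (meson obtain_subset_with_card_n)
  then show ?thesis using that by (auto simp: card_2_iff)
qed

text \<open>A partial identity is the product of two partial identities, each with its own extra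
  point. Otherwise some kernel class has a non-fixed point: \<open>\<beta>\<close> splits this class
  by sending all of it except \<open>m\<close> to \<open>m + 1\<close>, and \<open>\<gamma>\<close>
  merges \<open>m + 1\<close> with \<open>m\<close> again.\<close>

lemma idempotent_factors:
  assumes "e \<in> idempotents n q" "q + 3 \<le> n"
  shows "\<exists>\<beta>\<in>SS'_rank n (Suc q). \<exists>\<gamma>\<in>SS'_rank n (Suc q). e = pcomp \<beta> \<gamma>"
proof -
  have e: "e \<in> SS' n" "card (ran e) = q" and idem: "\<And>x y. e x = Some y \<Longrightarrow> e y = Some y"
    using assms(1) by (auto simp: idempotents_def SS'_rank_def)
  note fin = finite_ran_SS'[OF e(1)]
  have fixed: "e m = Some m" if "m \<in> ran e" for m
    using that idem by (auto simp: ran_def)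
  have M: "ran e \<subseteq> {2..n}"
    using SS'_bounds[OF e(1) fixed] by auto
  obtain c c' where c: "c \<in> {2..n} - ran e" "c' \<in> {2..n} - ran e" "c \<noteq> c'"
    using two_points_outside[OF M] e(2) assms(2) by metis
  show ?thesis
  proof (cases "dom e \<subseteq> ran e")
    case True
    have "e x = pcomp (identity_on (insert c (ran e))) (identity_on (insert c' (ran e))) x" for x
    proof (cases "x \<in> ran e")
      case True
      then show ?thesis using fixed by (simp add: pcomp_apply identity_on_def)
    next
      case False
      then have "e x = None" using \<open>dom e \<subseteq> ran e\<close> by blast
      then show ?thesis using False c by (auto simp: pcomp_apply identity_on_def)
    qed
    then have "e = pcomp (identity_on (insert c (ran e))) (identity_on (insert c' (ran e)))" ..
    moreover have "identity_on (insert c (ran e)) \<in> SS'_rank n (Suc q)"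
      "identity_on (insert c' (ran e)) \<in> SS'_rank n (Suc q)"
      using c M e(2) fin by (auto intro!: identity_on_SS'_rank)
    ultimately show ?thesis by blast
  next
    case False
    then obtain y m where y: "e y = Some m" "y \<notin> ran e" by blast
    have m: "m \<in> ran e" using y by (auto intro: ranI)
    then have "m \<noteq> y" using y by blast
    then have my: "m + 1 \<le> y" using SS'_bounds[OF e(1) y(1)] by simp
    \<comment> \<open>An image point \<open>m + 1\<close> would be fixed, while the larger or equal
      point \<open>y\<close> goes to \<open>m\<close>.\<close>
    have notin: "m + 1 \<notin> ran e"
      using SS'_mono[OF e(1) fixed y(1) my] by auto
    \<comment> \<open>At most one of \<open>c\<close> and \<open>c'\<close> equals
      \<open>m + 1\<close>. The other one lies outside the image of \<open>\<beta>\<close>, so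
      \<open>\<gamma>\<close> may fix it to gain rank without changing the product.\<close>
    obtain z where z: "z \<in> {2..n} - ran e" "z \<noteq> m + 1" using c by metis
    define \<beta> where "\<beta> = (\<lambda>x. if e x = Some m \<and> x \<noteq> m then Some (m + 1) else e x)"
    define \<gamma> where
      "\<gamma> = (\<lambda>x. if x = m + 1 then Some m else if x \<in> insert z (ran e) then Some x else None)"
    have block: "m < x" if "e x = Some m" "x \<noteq> m" for x
      using SS'_bounds[OF e(1) that(1)] that(2) by simp
    have "e = pcomp \<beta> \<gamma>"
    proof
      fix x
      show "e x = pcomp \<beta> \<gamma> x"
        using notin ranI[of e x] by (cases "e x") (auto simp: pcomp_apply \<beta>_def \<gamma>_def)
    qed
    moreover have "\<beta> \<in> SS'_rank n (Suc q)"
    proof -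
      have "ran \<beta> = insert (m + 1) (ran e)"
      proof
        show "ran \<beta> \<subseteq> insert (m + 1) (ran e)"
          unfolding \<beta>_def ran_def by (auto split: if_splits)
        have "\<beta> y = Some (m + 1)" using y \<open>m \<noteq> y\<close> by (simp add: \<beta>_def)
        moreover have "\<beta> k = Some k" if "k \<in> ran e" for k
          using fixed[OF that] by (auto simp: \<beta>_def)
        ultimately show "insert (m + 1) (ran e) \<subseteq> ran \<beta>" by (blast intro: ranI)
      qed
      then have "card (ran \<beta>) = Suc q" using notin fin e(2) by simp
      moreover have "u \<le> v" if uv: "\<beta> k = Some u" "\<beta> l = Some v" "k \<le> l" for k l u v
      proof -
        obtain u' v' where uv': "e k = Some u'" "e l = Some v'"
          using uv unfolding \<beta>_def by (auto split: if_splits)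
        then have le: "u' \<le> v'" using SS'_mono[OF e(1)] uv(3) by blast
        show ?thesis
          using uv uv' le block[of k] unfolding \<beta>_def by (auto split: if_splits)
      qed
      moreover have "2 \<le> k \<and> k \<le> n \<and> 1 \<le> u \<and> u \<le> k" if "\<beta> k = Some u" for k u
        using that SS'_bounds[OF e(1)] block[of k] unfolding \<beta>_def
        by (auto split: if_splits)
      ultimately show ?thesis unfolding SS'_rank_def SS'_iff by blast
    qed
    moreover have "\<gamma> \<in> SS'_rank n (Suc q)"
    proof -
      have "ran \<gamma> = insert z (ran e)"
        using m z notin unfolding \<gamma>_def by (auto simp: ran_def)
      then have "card (ran \<gamma>) = Suc q" using z fin e(2) by simp
      moreover have "\<gamma> \<in> SS' n"
      proof -
        have "2 \<le> m" using m M by auto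
        moreover have "m + 1 \<le> n" using my SS'_bounds[OF e(1) y(1)] by simp
        moreover have "2 \<le> k \<and> k \<le> n" if "k \<in> insert z (ran e)" for k
          using that z M by auto
        ultimately have "2 \<le> k \<and> k \<le> n \<and> 1 \<le> u \<and> u \<le> k" if "\<gamma> k = Some u" for k u
          using that unfolding \<gamma>_def by (fastforce split: if_splits)
        moreover have "u \<le> v" if uv: "\<gamma> k = Some u" "\<gamma> l = Some v" "k \<le> l" for k l u v
          using that unfolding \<gamma>_def by (auto split: if_splits)
        ultimately show ?thesis unfolding SS'_iff by blast
      qed
      ultimately show ?thesis by (simp add: SS'_rank_def)
    qed
    ultimately show ?thesis by blast
  qed
qed

text \<open>The second factor is the shift with an additional fixed point \<open>c'\<close>. The
  first is the identity on the old domain with a different point \<open>c\<close> added, so neither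
  extra point survives in the product.\<close>

lemma shift_below_gap_factors:
  assumes I: "I \<in> pointed_sets n q" and "q + 3 \<le> n"
  shows "\<exists>\<beta>\<in>SS'_rank n (Suc q). \<exists>\<gamma>\<in>SS'_rank n (Suc q). shift_below_gap I = pcomp \<beta> \<gamma>"
proof -
  define D where "D = insert (gap I) I - {1}"
  have I': "I \<subseteq> {1..n}" "1 \<in> I" "card I = q" and fin: "finite I"
    using I finite_subset[of I "{1..n}"] by (auto simp: pointed_sets_def)
  note g = gap_pos[OF fin] gap_notin[OF fin]
  have s: "shift_below_gap I \<in> SS' n" "ran (shift_below_gap I) = I"
    using shift_below_gap[OF I] assms(2) by (auto simp: SS'_rank_def)
  have dom: "shift_below_gap I x = None \<longleftrightarrow> x \<notin> D" for x
    by (auto simp: shift_below_gap_def D_def)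
  have D: "D \<subseteq> {2..n}" using dom SS'_bounds[OF s(1)] by fastforce
  \<comment> \<open>Passing from \<open>I\<close> to \<open>D\<close> exchanges \<open>1\<close> for
    the gap.\<close>
  have cD: "card D = q" using I' g fin by (simp add: D_def)
  have finD: "finite D" using fin by (simp add: D_def)
  obtain c c' where c: "c \<in> {2..n} - D" "c' \<in> {2..n} - D" "c \<noteq> c'"
    using two_points_outside[OF D] cD assms(2) by metis
  \<comment> \<open>All positive points below the gap are in \<open>I\<close>, so \<open>c'\<close>
    lies above it. There the shift is the identity, and fixing \<open>c'\<close> keeps the map
    isotone.\<close>
  have c'_gt: "gap I < c'" "c' \<notin> I"
  proof -
    show "c' \<notin> I" using c by (auto simp: D_def)
    moreover have "c' \<noteq> gap I" "0 < c'" using c g I' by (auto simp: D_def)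
    ultimately show "gap I < c'" using less_gap[of c' I] by force
  qed
  let ?\<gamma> = "(shift_below_gap I)(c' \<mapsto> c')"
  have "shift_below_gap I x = pcomp (identity_on (insert c D)) ?\<gamma> x" for x
    using dom[of x] c by (auto simp: pcomp_apply identity_on_def)
  then have "shift_below_gap I = pcomp (identity_on (insert c D)) ?\<gamma>" ..
  moreover have "identity_on (insert c D) \<in> SS'_rank n (Suc q)"
    using c D cD finD by (auto intro!: identity_on_SS'_rank)
  moreover have "?\<gamma> \<in> SS'_rank n (Suc q)"
  proof -
    have "ran ?\<gamma> = insert c' I" using dom[of c'] c s(2) by simp
    then have "card (ran ?\<gamma>) = Suc q" using c'_gt fin I' by simp
    moreover have "2 \<le> k \<and> k \<le> n \<and> 1 \<le> u \<and> u \<le> k" if "?\<gamma> k = Some u" for k u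
      using that SS'_bounds[OF s(1), of k u] c by (auto split: if_splits)
    moreover have "u \<le> v" if uv: "?\<gamma> k = Some u" "?\<gamma> l = Some v" "k \<le> l" for k l u v
    proof -
      have "u \<le> k" using uv(1) SS'_bounds[OF s(1), of k u] by (auto split: if_splits)
      moreover have "v = l" if "c' \<le> l"
        using uv(2) that c'_gt by (auto simp: shift_below_gap_def split: if_splits)
      ultimately have "u \<le> v" if "c' \<le> l" using that uv(3) by simp
      then show ?thesis
      proof (cases "c' \<le> l")
        case False
        then have "shift_below_gap I k = Some u" "shift_below_gap I l = Some v"
          using uv by auto
        then show ?thesis using SS'_mono[OF s(1)] uv(3) by blast
      qed blast
    qed
    ultimately show ?thesis unfolding SS'_rank_def SS'_iff by blast
  qed
  ultimately show ?thesis by blast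
qed

lemma SS'_rank_Suc:
  assumes "q + 3 \<le> n"
  shows "SS'_rank n q \<subseteq> subsemigroup_generated pcomp (SS'_rank n (Suc q))"
proof -
  have "idempotents n q \<union> shift_below_gap ` pointed_sets n q
      \<subseteq> subsemigroup_generated pcomp (SS'_rank n (Suc q))"
    using idempotent_factors[OF _ assms] shift_below_gap_factors[OF _ assms]
    by (fastforce intro: subsemigroup_generated.intros)
  then show ?thesis
    using SS'_rank_subset_generated[of q n] subsemigroup_generated_least assms
    by (meson dual_order.trans less_add_same_cancel1 order_less_le_trans zero_less_numeral)
qed

lemma K_eq_generated:
  assumes "p + 2 \<le> n"
  shows "subsemigroup_generated pcomp (idempotents n p \<union> shift_below_gap ` pointed_sets n p) = K n p"
    (is "subsemigroup_generated pcomp ?A = _")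
proof
  have "?A \<subseteq> K n p"
    using shift_below_gap(1)[of _ n p] assms
    unfolding idempotents_def SS'_rank_def K_def by fastforce
  then show "subsemigroup_generated pcomp ?A \<subseteq> K n p"
    using subsemigroup_generated_least[of ?A pcomp "K n p"] by (simp add: subsemigroup_generated_K)
  have "SS'_rank n q \<subseteq> subsemigroup_generated pcomp ?A" if "q \<le> p" for q
    using that
  \<comment> \<open>The induction descends from \<open>q = p\<close>. In the step
    \<open>q < p\<close>, so \<open>p + 2 \<le> n\<close> gives the bound
    \<open>q + 3 \<le> n\<close> required for factoring.\<close>
  proof (induction q rule: inc_induct)
    case base
    then show ?case using SS'_rank_subset_generated assms by simp
  next
    case (step q)
    then show ?case
      using SS'_rank_Suc[of q n] subsemigroup_generated_least[OF step.IH] assms by auto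
  qed
  moreover have "K n p = (\<Union>q\<le>p. SS'_rank n q)"
    by (auto simp: K_def SS'_rank_def)
  ultimately show "K n p \<subseteq> subsemigroup_generated pcomp ?A" by blast
qed

section \<open>Lower bound for generating sets\<close>

text \<open>Any generator word of a rank-\<open>p\<close> element keeps the rank throughout: its first letter has the
  same domain and kernel and dominates the product pointwise, its last letter has the same image.\<close>

lemma generated_first_last:
  assumes "x \<in> subsemigroup_generated pcomp A" "A \<subseteq> K n p" "card (ran x) = p"
  shows "(\<exists>a\<in>A. dom a = dom x \<and> (\<forall>z u v. x z = Some u \<longrightarrow> a z = Some v \<longrightarrow> u \<le> v) \<and>
      (\<forall>z\<in>dom x. \<forall>w\<in>dom x. x z = x w \<longrightarrow> a z = a w)) \<and> (\<exists>b\<in>A. ran b = ran x)"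
  using assms
proof induction
  case (incl a)
  then show ?case by (intro conjI bexI[of _ a]) auto
next
  case (mult a b)
  have "subsemigroup_generated pcomp A \<subseteq> K n p"
    using subsemigroup_generated_least[of A pcomp "K n p"] mult.prems
    by (simp add: subsemigroup_generated_K)
  then have a: "a \<in> SS' n" "card (ran a) \<le> p" and b: "b \<in> SS' n" "card (ran b) \<le> p"
    using mult.hyps by (auto simp: K_def)
  have sub: "ran (pcomp a b) \<subseteq> ran b"
    by (auto simp: ran_def pcomp_eq_Some)
  then have ranb: "ran (pcomp a b) = ran b"
    using b mult.prems(2) finite_ran_SS'[OF b(1)] by (metis card_seteq)
  have img: "ran (pcomp a b) = (\<lambda>y. the (b y)) ` (ran a \<inter> dom b)"
  proof
    show "ran (pcomp a b) \<subseteq> (\<lambda>y. the (b y)) ` (ran a \<inter> dom b)"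
    proof
      fix z assume "z \<in> ran (pcomp a b)"
      then obtain x y where "a x = Some y" "b y = Some z" by (auto simp: ran_def pcomp_eq_Some)
      then show "z \<in> (\<lambda>y. the (b y)) ` (ran a \<inter> dom b)"
        by (intro image_eqI[of _ _ y]) (auto intro: ranI)
    qed
    show "(\<lambda>y. the (b y)) ` (ran a \<inter> dom b) \<subseteq> ran (pcomp a b)"
      by (fastforce simp: ran_def pcomp_eq_Some)
  qed
  note fin = finite_ran_SS'[OF a(1)]
  \<comment> \<open>The product has rank \<open>p\<close> and \<open>a\<close> has rank at most
    \<open>p\<close>, so all inequalities in this chain are equalities: \<open>a\<close> has rank
    \<open>p\<close>, and \<open>b\<close> is defined and injective on all of
    \<open>ran a\<close>.\<close>
  have "p \<le> card (ran a \<inter> dom b)"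
    using img mult.prems(2) card_image_le[of "ran a \<inter> dom b" "\<lambda>y. the (b y)"] fin by simp
  moreover have "card (ran a \<inter> dom b) \<le> card (ran a)" using fin by (intro card_mono) auto
  ultimately have ca: "card (ran a) = p" and "card (ran a \<inter> dom b) = card (ran a)"
    using a(2) by auto
  then have sub2: "ran a \<inter> dom b = ran a" using fin by (intro card_subset_eq) auto
  have inj: "inj_on (\<lambda>y. the (b y)) (ran a)"
    using img sub2 ca mult.prems(2) fin by (intro eq_card_imp_inj_on) auto
  have bdom: "\<exists>v. b y = Some v" if "a x = Some y" for x y
    using sub2 ranI[of a x y] that by blast
  have dom: "dom (pcomp a b) = dom a"
    using bdom by (auto simp: pcomp_eq_Some dom_def)
  have le: "u \<le> v" if "pcomp a b z = Some u" "a z = Some v" for z u v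
    using that SS'_bounds(4)[OF b(1)] by (auto simp: pcomp_eq_Some)
  have ker: "a z = a w" if zw: "z \<in> dom a" "w \<in> dom a" "pcomp a b z = pcomp a b w" for z w
  proof -
    obtain u v where uv: "a z = Some u" "a w = Some v" using zw by blast
    then have "b u = b v" using zw by (simp add: pcomp_apply)
    then have "u = v"
      using inj_onD[OF inj, of u v] ranI[of a z u] ranI[of a w v] uv by simp
    then show ?thesis using uv by simp
  qed
  \<comment> \<open>The first letter for \<open>a\<close> also serves for the product, which has the
    same domain and kernel as \<open>a\<close> and lies pointwise below it.\<close>
  from mult.IH(1)[OF mult.prems(1) ca] obtain c where c: "c \<in> A" "dom c = dom a"
    "\<And>z u v. a z = Some u \<Longrightarrow> c z = Some v \<Longrightarrow> u \<le> v"
    "\<And>z w. z \<in> dom a \<Longrightarrow> w \<in> dom a \<Longrightarrow> a z = a w \<Longrightarrow> c z = c w" by blast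
  have "u \<le> v" if uv: "pcomp a b z = Some u" "c z = Some v" for z u v
  proof -
    obtain t where t: "a z = Some t" using uv(1) by (auto simp: pcomp_eq_Some)
    show ?thesis using le[OF uv(1) t] c(3)[OF t uv(2)] by simp
  qed
  moreover have "c z = c w"
    if "z \<in> dom (pcomp a b)" "w \<in> dom (pcomp a b)" "pcomp a b z = pcomp a b w" for z w
    using that ker c(4) unfolding dom by blast
  moreover have "dom c = dom (pcomp a b)" using c(2) dom by simp
  ultimately have "\<exists>c\<in>A. dom c = dom (pcomp a b) \<and>
      (\<forall>z u v. pcomp a b z = Some u \<longrightarrow> c z = Some v \<longrightarrow> u \<le> v) \<and>
      (\<forall>z\<in>dom (pcomp a b). \<forall>w\<in>dom (pcomp a b). pcomp a b z = pcomp a b w \<longrightarrow> c z = c w)"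
    using c(1) by blast
  moreover have "\<exists>d\<in>A. ran d = ran (pcomp a b)"
    using mult.IH(2) mult.prems ranb by simp
  ultimately show ?case by blast
qed

text \<open>The first letter \<open>a\<close> of a word for \<open>e\<close> dominates
  \<open>e\<close> and is order-decreasing, so it fixes every image point of \<open>e\<close>. Being
  constant on the kernel classes of \<open>e\<close>, it equals \<open>e\<close>.\<close>

lemma idempotents_subset_generators:
  assumes "A \<subseteq> K n p" "subsemigroup_generated pcomp A = K n p"
  shows "idempotents n p \<subseteq> A"
proof
  fix e assume "e \<in> idempotents n p"
  then have e: "e \<in> SS' n" "card (ran e) = p" and idem: "\<And>x y. e x = Some y \<Longrightarrow> e y = Some y"
    by (auto simp: idempotents_def SS'_rank_def)
  then have "e \<in> subsemigroup_generated pcomp A" using assms by (simp add: K_def)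
  from generated_first_last[OF this assms(1) e(2)] obtain a where
    a: "a \<in> A" "dom a = dom e" "\<And>z u v. e z = Some u \<Longrightarrow> a z = Some v \<Longrightarrow> u \<le> v"
    "\<And>z w. z \<in> dom e \<Longrightarrow> w \<in> dom e \<Longrightarrow> e z = e w \<Longrightarrow> a z = a w" by blast
  have aS: "a \<in> SS' n" using a(1) assms(1) by (auto simp: K_def)
  have "a = e"
  proof
    fix z
    show "a z = e z"
    proof (cases "e z")
      case None
      then show ?thesis using a(2) by (metis domIff)
    next
      case (Some m)
      then have em: "e m = Some m" by (rule idem)
      then obtain v where v: "a m = Some v" using a(2) by (metis domD domI)
      have "v = m" using a(3)[OF em v] SS'_bounds(4)[OF aS v] by simp
      moreover have "a z = a m" using a(4)[of z m] Some em by (simp add: domI)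
      ultimately show ?thesis using Some v by simp
    qed
  qed
  then show "e \<in> A" using a(1) by simp
qed

text \<open>The idempotents and the generators with \<open>1\<close> in their image are disjoint
  parts of \<open>A\<close>, and taking images maps the second part onto a family containing all
  pointed sets.\<close>

lemma card_generators_ge:
  assumes "A \<subseteq> K n p" "subsemigroup_generated pcomp A = K n p" "p < n"
  shows "card (pointed_sets n p) + card (idempotents n p) \<le> card A"
proof -
  let ?E = "idempotents n p" let ?B = "{b \<in> A. 1 \<in> ran b}"
  have finA: "finite A" using assms(1) finite_K finite_subset by blast
  have E: "?E \<subseteq> A" by (rule idempotents_subset_generators) fact+
  have disj: "?B \<inter> ?E = {}"
  proof -
    \<comment> \<open>An idempotent fixes its image points, but \<open>1\<close> is outside the
      domain.\<close>
    have "1 \<notin> ran e" if "e \<in> ?E" for e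
    proof
      assume "1 \<in> ran e"
      then have "e 1 = Some 1" using that by (auto simp: ran_def idempotents_def)
      then show False using that SS'_bounds(1)[of e n 1 1]
        by (auto simp: idempotents_def SS'_rank_def)
    qed
    then show ?thesis by blast
  qed
  \<comment> \<open>\<open>shift_below_gap I\<close> is an element of rank \<open>p\<close> with
    image \<open>I\<close>; the last letter of a word for it is a generator with image
    \<open>I\<close>.\<close>
  have "pointed_sets n p \<subseteq> ran ` ?B"
  proof
    fix I assume I: "I \<in> pointed_sets n p"
    note s = shift_below_gap[OF I assms(3)]
    have "shift_below_gap I \<in> subsemigroup_generated pcomp A" "card (ran (shift_below_gap I)) = p"
      using s assms(2) by (auto simp: SS'_rank_def K_def)
    from generated_first_last[OF this(1) assms(1) this(2)] obtain b where "b \<in> A" "ran b = I"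
      using s(2) by auto
    then show "I \<in> ran ` ?B" using I by (auto simp: pointed_sets_def)
  qed
  then have "card (pointed_sets n p) \<le> card ?B"
    using finA by (intro surj_card_le) auto
  moreover have "card ?B + card ?E = card (?B \<union> ?E)"
    using disj finA E by (subst card_Un_disjoint) (auto intro: finite_subset)
  moreover have "card (?B \<union> ?E) \<le> card A"
    using E finA by (intro card_mono) auto
  ultimately show ?thesis by linarith
qed

section \<open>Counting the generators\<close>

lemma card_subsets_containing:
  assumes "finite D" "a \<in> D" "1 \<le> p"
  shows "card {M. M \<subseteq> D \<and> a \<in> M \<and> card M = p} = (card D - 1) choose (p - 1)"
proof -
  have "bij_betw (insert a) {T. T \<subseteq> D - {a} \<and> card T = p - 1} {M. M \<subseteq> D \<and> a \<in> M \<and> card M = p}"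
  proof (rule bij_betw_byWitness[where f' = "\<lambda>M. M - {a}"])
    show "insert a ` {T. T \<subseteq> D - {a} \<and> card T = p - 1} \<subseteq> {M. M \<subseteq> D \<and> a \<in> M \<and> card M = p}"
    proof
      fix M assume "M \<in> insert a ` {T. T \<subseteq> D - {a} \<and> card T = p - 1}"
      then obtain T where T: "T \<subseteq> D - {a}" "card T = p - 1" "M = insert a T" by blast
      moreover have "finite T" "a \<notin> T" using T assms(1) by (auto intro: finite_subset)
      ultimately show "M \<in> {M. M \<subseteq> D \<and> a \<in> M \<and> card M = p}" using assms by auto
    qed
    show "(\<lambda>M. M - {a}) ` {M. M \<subseteq> D \<and> a \<in> M \<and> card M = p} \<subseteq> {T. T \<subseteq> D - {a} \<and> card T = p - 1}"
      by (intro image_subsetI) (auto simp: card_Diff_singleton)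
    show "\<forall>T\<in>{T. T \<subseteq> D - {a} \<and> card T = p - 1}. insert a T - {a} = T" by blast
    show "\<forall>M\<in>{M. M \<subseteq> D \<and> a \<in> M \<and> card M = p}. insert a (M - {a}) = M" by blast
  qed
  then have "card {M. M \<subseteq> D \<and> a \<in> M \<and> card M = p} = card {T. T \<subseteq> D - {a} \<and> card T = p - 1}"
    by (rule bij_betw_same_card[symmetric])
  also have "\<dots> = (card D - 1) choose (p - 1)"
    using assms n_subsets[of "D - {a}" "p - 1"] by (simp add: card_Diff_singleton)
  finally show ?thesis .
qed

lemma card_pointed_sets:
  assumes "1 \<le> p" "1 \<le> n"
  shows "card (pointed_sets n p) = (n - 1) choose (p - 1)"
  using card_subsets_containing[of "{1..n}" 1 p] assms by (simp add: pointed_sets_def)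

lemma sum_Pow_card:
  fixes h :: "nat \<Rightarrow> nat"
  assumes "finite A"
  shows "(\<Sum>D\<in>Pow A. h (card D)) = (\<Sum>r\<le>card A. (card A choose r) * h r)"
proof -
  have "(\<Sum>D\<in>Pow A. h (card D)) = (\<Sum>r\<le>card A. \<Sum>D\<in>{D \<in> Pow A. card D = r}. h (card D))"
    using assms by (intro sum.group[symmetric]) (auto intro: card_mono)
  also have "\<dots> = (\<Sum>r\<le>card A. (card A choose r) * h r)"
    using assms by (intro sum.cong) (auto simp: n_subsets)
  finally show ?thesis .
qed

text \<open>A decreasing isotone idempotent sends each point of its domain to the largest image point
  below it.\<close>

definition collapse :: "nat set \<Rightarrow> nat set \<Rightarrow> (nat \<rightharpoonup> nat)" where
  "collapse D M = (\<lambda>x. if x \<in> D then Some (Max {m \<in> M. m \<le> x}) else None)"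

text \<open>Image points are fixed, so by isotonicity every image point \<open>m \<le> x\<close> is
  at most the value at \<open>x\<close>, which is itself such a point.\<close>

lemma idempotent_eq_collapse:
  assumes "e \<in> idempotents n p"
  shows "collapse (dom e) (ran e) = e"
proof
  fix x
  have e: "e \<in> SS' n" and idem: "\<And>x y. e x = Some y \<Longrightarrow> e y = Some y"
    using assms by (auto simp: idempotents_def SS'_rank_def)
  show "collapse (dom e) (ran e) x = e x"
  proof (cases "e x")
    case None
    then show ?thesis by (auto simp: collapse_def)
  next
    case (Some y)
    have "Max {m \<in> ran e. m \<le> x} = y"
    proof (rule Max_eqI)
      show "finite {m \<in> ran e. m \<le> x}" using finite_ran_SS'[OF e] by simp
      show "y \<in> {m \<in> ran e. m \<le> x}"
        using Some SS'_bounds(4)[OF e Some] by (auto intro: ranI)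
      fix m assume "m \<in> {m \<in> ran e. m \<le> x}"
      then have "e m = Some m" "m \<le> x" using idem by (auto simp: ran_def)
      then show "m \<le> y" using SS'_mono[OF e _ Some] by blast
    qed
    then show ?thesis using Some by (simp add: collapse_def domI)
  qed
qed

text \<open>The condition \<open>Min D \<in> M\<close> ensures that the set under \<open>Max\<close>
  is nonempty for each \<open>x \<in> D\<close>.\<close>

lemma collapse_idempotent:
  assumes D: "D \<subseteq> {2..n}" and M: "M \<subseteq> D" "Min D \<in> M" "card M = p"
  shows "collapse D M \<in> idempotents n p" "dom (collapse D M) = D" "ran (collapse D M) = M"
proof -
  have finD: "finite D" using D by (rule finite_subset) simp
  then have finM: "finite M" using M(1) finite_subset by blast
  have Mx: "Max {m \<in> M. m \<le> x} \<in> {m \<in> M. m \<le> x}" if "x \<in> D" for x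
    using finM M(2) Min_le[OF finD that] by (intro Max_in) auto
  have fixed: "Max {m \<in> M. m \<le> x} = x" if "x \<in> M" for x
    using that finM by (intro Max_eqI) auto
  show dom: "dom (collapse D M) = D" by (auto simp: collapse_def split: if_splits)
  have fixed': "collapse D M x = Some x" if "x \<in> M" for x
    using that fixed M(1) by (auto simp: collapse_def)
  have val: "x \<in> D" "y \<in> M" "y \<le> x" "y = Max {m \<in> M. m \<le> x}" if "collapse D M x = Some y" for x y
    using that Mx[of x] by (auto simp: collapse_def split: if_splits)
  show ran: "ran (collapse D M) = M"
    using val(2) fixed' by (auto simp: ran_def)
  have "u \<le> v" if "collapse D M x = Some u" "collapse D M y = Some v" "x \<le> y" for x y u v
    unfolding val(4)[OF that(2)] using val[OF that(1)] that(3) finM by (intro Max_ge) auto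
  moreover have "2 \<le> x \<and> x \<le> n \<and> 1 \<le> y \<and> y \<le> x" if "collapse D M x = Some y" for x y
    using val[OF that] D M(1) by fastforce
  ultimately have "collapse D M \<in> SS' n" unfolding SS'_iff by blast
  then show "collapse D M \<in> idempotents n p"
    using ran M(3) fixed' val(2) by (auto simp: idempotents_def SS'_rank_def)
qed

text \<open>Domain and image determine an idempotent. For a domain of size \<open>r \<ge> 1\<close>,
  the image is any \<open>p\<close>-subset containing its minimum; summing over domains by size
  gives the formula.\<close>

lemma card_idempotents:
  assumes "1 \<le> p"
  shows "card (idempotents n p) = (\<Sum>r=p..n - 1. ((n - 1) choose r) * ((r - 1) choose (p - 1)))"
proof -
  let ?F = "\<lambda>D. {M. M \<subseteq> D \<and> Min D \<in> M \<and> card M = p}"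
  have "bij_betw (\<lambda>e. (dom e, ran e)) (idempotents n p) (Sigma (Pow {2..n}) ?F)"
  proof (rule bij_betw_byWitness[where f' = "\<lambda>(D, M). collapse D M"])
    show "\<forall>e\<in>idempotents n p. (\<lambda>(D, M). collapse D M) (dom e, ran e) = e"
      using idempotent_eq_collapse by auto
    show "\<forall>z\<in>Sigma (Pow {2..n}) ?F. (dom ((\<lambda>(D, M). collapse D M) z), ran ((\<lambda>(D, M). collapse D M) z)) = z"
      using collapse_idempotent(2,3) by auto
    show "(\<lambda>(D, M). collapse D M) ` Sigma (Pow {2..n}) ?F \<subseteq> idempotents n p"
      using collapse_idempotent(1) by auto
    show "(\<lambda>e. (dom e, ran e)) ` idempotents n p \<subseteq> Sigma (Pow {2..n}) ?F"
    proof (rule image_subsetI)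
      fix e assume "e \<in> idempotents n p"
      then have e: "e \<in> SS' n" "card (ran e) = p" and idem: "\<And>x y. e x = Some y \<Longrightarrow> e y = Some y"
        by (auto simp: idempotents_def SS'_rank_def)
      have D: "dom e \<subseteq> {2..n}" using SS'_bounds[OF e(1)] by fastforce
      then have fin: "finite (dom e)" by (rule finite_subset) simp
      have sub: "ran e \<subseteq> dom e" using idem by (auto simp: ran_def)
      have "ran e \<noteq> {}" using e(2) assms by auto
      then have "dom e \<noteq> {}" using sub by blast
      then have "Min (dom e) \<in> dom e" using fin Min_in by blast
      then obtain y where y: "e (Min (dom e)) = Some y" by blast
      \<comment> \<open>The value at the minimum is fixed, hence in the domain, so it cannot lie
        below the minimum; as \<open>e\<close> is decreasing, the minimum is fixed.\<close>
      then have "Min (dom e) \<le> y" using idem Min_le[OF fin] by blast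
      then have "y = Min (dom e)" using SS'_bounds(4)[OF e(1) y] by simp
      then have "Min (dom e) \<in> ran e" using y by (auto intro: ranI)
      then show "(dom e, ran e) \<in> Sigma (Pow {2..n}) ?F" using D sub e(2) by blast
    qed
  qed
  then have "card (idempotents n p) = card (Sigma (Pow {2..n}) ?F)"
    by (rule bij_betw_same_card)
  also have "\<dots> = (\<Sum>D\<in>Pow {2..n}. card (?F D))"
    by (intro card_SigmaI) (auto intro!: finite_subset[of _ "Pow {2..n}"])
  \<comment> \<open>The empty domain contributes zero but needs its own case: for
    \<open>p = 1\<close>, truncated subtraction would turn its term into
    \<open>0 choose 0 = 1\<close>.\<close>
  also have "\<dots> = (\<Sum>D\<in>Pow {2..n}. if card D = 0 then 0 else (card D - 1) choose (p - 1))"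
  proof (rule sum.cong)
    fix D :: "nat set" assume "D \<in> Pow {2..n}"
    then have fin: "finite D" using finite_subset by auto
    show "card (?F D) = (if card D = 0 then 0 else (card D - 1) choose (p - 1))"
    proof (cases "D = {}")
      case True
      then show ?thesis by simp
    next
      case False
      then show ?thesis using card_subsets_containing[OF fin Min_in[OF fin False] assms] fin by simp
    qed
  qed simp
  also have "\<dots> = (\<Sum>r\<le>n - 1. ((n - 1) choose r) * (if r = 0 then 0 else (r - 1) choose (p - 1)))"
    using sum_Pow_card[of "{2..n}" "\<lambda>r. if r = 0 then 0 else (r - 1) choose (p - 1)"] by simp
  \<comment> \<open>For \<open>0 < r < p\<close> the second binomial coefficient vanishes, and the
    term for \<open>r = 0\<close> is zero by definition.\<close>
  also have "\<dots> = (\<Sum>r=p..n - 1. ((n - 1) choose r) * ((r - 1) choose (p - 1)))"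
    using assms by (intro sum.mono_neutral_cong_right) (auto simp: binomial_eq_0)
  finally show ?thesis .
qed

theorem theorem3p13:
  fixes n p :: nat
  assumes "n \<ge> 2" and "1 \<le> p" and "p \<le> n - 2"
  shows "semigroup_rank pcomp (K n p) =
    ((n - 1) choose (p - 1)) + (\<Sum>r=p..n - 1. ((n - 1) choose r) * ((r - 1) choose (p - 1)))"
proof -
  let ?A = "idempotents n p \<union> shift_below_gap ` pointed_sets n p"
  let ?k = "card (pointed_sets n p) + card (idempotents n p)"
  have p: "p + 2 \<le> n" using assms by simp
  have gen: "subsemigroup_generated pcomp ?A = K n p" by (rule K_eq_generated[OF p])
  then have sub: "?A \<subseteq> K n p" by (auto intro: subsemigroup_generated.incl)
  then have fin: "finite ?A" using finite_K finite_subset by blast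
  have ge: "?k \<le> card A" if "A \<subseteq> K n p" "subsemigroup_generated pcomp A = K n p" for A
    using card_generators_ge[OF that] p by simp
  \<comment> \<open>The union and image estimates only give an upper bound; the lower bound applied
    to \<open>?A\<close> itself turns it into an equality.\<close>
  have "card ?A \<le> card (idempotents n p) + card (shift_below_gap ` pointed_sets n p)"
    by (rule card_Un_le)
  also have "\<dots> \<le> ?k"
    using card_image_le[of "pointed_sets n p" shift_below_gap]
    by (simp add: pointed_sets_def finite_subset[of _ "Pow {1..n}"])
  finally have "card ?A = ?k" using ge[OF sub gen] by simp
  then have "semigroup_rank pcomp (K n p) = ?k"
    unfolding semigroup_rank_def using sub fin gen ge by (intro Least_equality) blast+
  then show ?thesis using card_pointed_sets card_idempotents assms by simp
qed

end
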